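(* Every semiperfect VNL ring $R$ is $2$-VNL; that is, whenever $a_1,a_2\in R$ satisfy $a_1R+a_2R=R$, at least one of $a_1,a_2$ is regular in $R$.
   Context: Rings are associative with identity. An element $a$ of a ring $R$ is (von Neumann) regular if $a=aba$ for some $b\in R$. A ring $R$ is VNL if for each $a\in R$, either $a$ or $1-a$ is regular in $R$. A ring $R$ is called (right) $n$-VNL if $a_1R+a_2R+\dots+a_nR=R$ with $a_1,\dots,a_n\in R$ implies that $a_i$ is regular for some $i$. *)

theory Defs
  imports "HOL-Algebra.QuotRing"
begin

locale right_ideal = additive_subgroup I R + ring R for I and R (structure) +
  assumes I_r_closed: "\<lbrakk> a \<in> I; x \<in> carrier R \<rbrakk> \<Longrightarrow> a \<otimes> x \<in> I"

locale maximal_right_ideal = right_ideal +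
  assumes I_notcarr: "carrier R \<noteq> I"
    and I_maximal:
      "\<lbrakk> right_ideal J R; I \<subseteq> J; J \<subseteq> carrier R \<rbrakk> \<Longrightarrow> J = I \<or> J = carrier R"

text \<open>The comprehension is guarded by the carrier, so that in the zero ring, which has no
  maximal right ideal, the radical is the whole ring. The radical is left-right symmetric
  and two-sided.\<close>

definition jacobson_radical :: "('a, 'b) ring_scheme \<Rightarrow> 'a set" where
  "jacobson_radical R = {x \<in> carrier R. \<forall>M. maximal_right_ideal M R \<longrightarrow> x \<in> M}"

text \<open>Semisimplicity of a ring as a right module over itself: every submodule of the regular
  module is a direct summand. This notion, too, is left-right symmetric.\<close>

locale semisimple_ring = ring R for R (structure) +
  assumes right_ideal_complemented:
    "right_ideal I R \<Longrightarrow> \<exists>K. right_ideal K R \<and> I <+>\<^bsub>R\<^esub> K = carrier R \<and> I \<inter> K = {\<zero>}"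

definition idempotent :: "('a, 'b) ring_scheme \<Rightarrow> 'a \<Rightarrow> bool" where
  "idempotent R e \<longleftrightarrow> e \<in> carrier R \<and> e \<otimes>\<^bsub>R\<^esub> e = e"

definition idempotents_lift_modulo :: "('a, 'b) ring_scheme \<Rightarrow> 'a set \<Rightarrow> bool" where
  "idempotents_lift_modulo R I \<longleftrightarrow>
     (\<forall>X. idempotent (R Quot I) X \<longrightarrow> (\<exists>e. idempotent R e \<and> I +>\<^bsub>R\<^esub> e = X))"

locale semiperfect_ring = ring R for R (structure) +
  assumes semisimple_modulo_radical: "semisimple_ring (R Quot (jacobson_radical R))"
    and idempotents_lift_modulo_radical: "idempotents_lift_modulo R (jacobson_radical R)"

definition regular_element :: "('a, 'b) ring_scheme \<Rightarrow> 'a \<Rightarrow> bool" where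
  "regular_element R a \<longleftrightarrow>
     a \<in> carrier R \<and> (\<exists>b \<in> carrier R. a = a \<otimes>\<^bsub>R\<^esub> b \<otimes>\<^bsub>R\<^esub> a)"

locale VNL_ring = ring R for R (structure) +
  assumes VNL: "a \<in> carrier R \<Longrightarrow> regular_element R a \<or> regular_element R (\<one> \<ominus> a)"

text \<open>The set comprehension is the sum of the principal right ideals generated by
  \<open>a 1, \<dots>, a n\<close>.\<close>

locale n_VNL_ring = ring R for n :: nat and R (structure) +
  assumes n_VNL:
    "\<lbrakk> a \<in> {1..n} \<rightarrow> carrier R;
       {(\<Oplus>i\<in>{1..n}. a i \<otimes> r i) | r. r \<in> {1..n} \<rightarrow> carrier R} = carrier R \<rbrakk>
     \<Longrightarrow> \<exists>i\<in>{1..n}. regular_element R (a i)"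

end

theory Submission
  imports Defs
begin

text \<open>
  Write \<open>J\<close> for the radical of \<open>R\<close>. Since \<open>R/J\<close> is unit-regular and idempotents lift, every \<open>a\<close>
  satisfies \<open>a x \<in> e + J\<close> for a unit \<open>x\<close> and an idempotent \<open>e\<close>; put \<open>f = 1 - e\<close>. If \<open>a\<close> is not
  regular, then \<open>f J f \<noteq> 0\<close>. If \<open>e J e\<close> also contained some \<open>q \<noteq> 0\<close>, then for \<open>0 \<noteq> p \<in> f J f\<close>
  neither \<open>p + e - q\<close> nor \<open>f - p + q\<close> would be regular, as nonzero elements of \<open>J\<close> never are; so
  the VNL condition forces \<open>e J e = 0\<close>, whence \<open>e R e\<close> is a regular ring. From \<open>a R + b R = R\<close> one
  gets \<open>f b y = f\<close> for a unit \<open>y\<close>, and row and column operations turn \<open>b y\<close> into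
  \<open>f + e b y e\<close>, which is regular.
\<close>

section \<open>Identities for products and complementary idempotents\<close>

text \<open>A rewriting aid: once \<open>m_assoc\<close> has nested products to the right, an
  equation for \<open>x \<otimes> y\<close> matches only at the end of a product; this form applies
  it in front of a further factor \<open>s\<close>.\<close>

lemma (in monoid) mult_eq_extend:
  assumes "x \<otimes> y = z" "x \<in> carrier G" "y \<in> carrier G" "s \<in> carrier G"
  shows "x \<otimes> (y \<otimes> s) = z \<otimes> s"
  using assms m_assoc by metis

lemma (in ring) minus_eq_zero_iff:
  assumes "x \<in> carrier R" "y \<in> carrier R"
  shows "x \<ominus> y = \<zero> \<longleftrightarrow> x = y"
  using assms by (metis minus_eq minus_equality minus_minus a_inv_closed r_neg)

lemma (in ring) complement_mult:
  assumes "u \<in> carrier R" "s \<in> carrier R"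
  shows "(\<one> \<ominus> u) \<otimes> s = s \<ominus> u \<otimes> s" "s \<otimes> (\<one> \<ominus> u) = s \<ominus> s \<otimes> u"
  using assms by (simp_all add: minus_eq l_distr r_distr l_minus r_minus)

lemma (in ring) complement_idempotent:
  assumes "u \<in> carrier R" "u \<otimes> u = u"
  shows "(\<one> \<ominus> u) \<otimes> (\<one> \<ominus> u) = \<one> \<ominus> u"
    "u \<otimes> (\<one> \<ominus> u) = \<zero>" "(\<one> \<ominus> u) \<otimes> u = \<zero>"
proof -
  show "u \<otimes> (\<one> \<ominus> u) = \<zero>" and z: "(\<one> \<ominus> u) \<otimes> u = \<zero>"
    using assms by (simp_all add: complement_mult minus_eq_zero_iff)
  show "(\<one> \<ominus> u) \<otimes> (\<one> \<ominus> u) = \<one> \<ominus> u"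
    using assms(1) complement_mult(2)[of u "\<one> \<ominus> u"] z by (simp add: minus_eq)
qed

section \<open>Right ideals\<close>

lemma (in ring) right_idealI:
  assumes "I \<subseteq> carrier R" "\<zero> \<in> I"
    and add: "\<And>x y. \<lbrakk>x \<in> I; y \<in> I\<rbrakk> \<Longrightarrow> x \<oplus> y \<in> I"
    and mult: "\<And>x r. \<lbrakk>x \<in> I; r \<in> carrier R\<rbrakk> \<Longrightarrow> x \<otimes> r \<in> I"
  shows "right_ideal I R"
proof -
  have "\<ominus> x \<in> I" if "x \<in> I" for x
  proof -
    have "\<ominus> x = x \<otimes> \<ominus> \<one>"
      using that assms(1) by (auto simp: r_minus)
    then show ?thesis
      using mult[OF that] by simp
  qed
  then have "additive_subgroup I R"
    using assms by (intro additive_subgroupI add.subgroupI) auto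
  then show ?thesis
    by (simp add: right_ideal_def right_ideal_axioms_def ring_axioms mult)
qed

lemma (in ring) right_ideal_principal:
  assumes "a \<in> carrier R"
  shows "right_ideal {a \<otimes> r |r. r \<in> carrier R} R"
proof (rule right_idealI)
  show "\<zero> \<in> {a \<otimes> r |r. r \<in> carrier R}"
    using assms by (force intro: exI[of _ \<zero>])
next
  fix x y assume "x \<in> {a \<otimes> r |r. r \<in> carrier R}" "y \<in> {a \<otimes> r |r. r \<in> carrier R}"
  then show "x \<oplus> y \<in> {a \<otimes> r |r. r \<in> carrier R}"
    using assms by clarify (metis r_distr a_closed)
next
  fix x s assume "x \<in> {a \<otimes> r |r. r \<in> carrier R}" "s \<in> carrier R"
  then show "x \<otimes> s \<in> {a \<otimes> r |r. r \<in> carrier R}"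
    using assms by clarify (metis m_assoc m_closed)
qed (use assms in auto)

lemma (in right_ideal) minus_closed_ideal:
  assumes "x \<in> I" "y \<in> I"
  shows "x \<ominus> y \<in> I"
  using assms by (simp add: minus_eq)

lemma (in right_ideal) mem_carrier:
  assumes "x \<in> I"
  shows "x \<in> carrier R"
  using assms a_subset by blast

text \<open>Supplies upper bounds for both Zorn arguments below. Two elements of the union lie in
  one common member, since members of a chain are comparable.\<close>

lemma (in ring) right_ideal_Union_chain:
  assumes "\<C> \<noteq> {}" "subset.chain \<A> \<C>" "\<And>I. I \<in> \<A> \<Longrightarrow> right_ideal I R"
  shows "right_ideal (\<Union>\<C>) R"
proof -
  have ri: "right_ideal I R" if "I \<in> \<C>" for I
    using that assms(2,3) by (auto simp: subset_chain_def)
  show ?thesis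
  proof (rule right_idealI)
    show "\<Union>\<C> \<subseteq> carrier R"
      using ri right_ideal.mem_carrier by fastforce
    show "\<zero> \<in> \<Union>\<C>"
      using assms(1) ri right_ideal.axioms(1) additive_subgroup.zero_closed by fastforce
  next
    fix x y assume "x \<in> \<Union>\<C>" "y \<in> \<Union>\<C>"
    then obtain I K where IK: "I \<in> \<C>" "x \<in> I" "K \<in> \<C>" "y \<in> K"
      by blast
    then have "I \<subseteq> K \<or> K \<subseteq> I"
      using assms(2) by (auto simp: subset_chain_def)
    then show "x \<oplus> y \<in> \<Union>\<C>"
      using IK ri right_ideal.axioms(1) additive_subgroup.a_closed by (metis UnionI subsetD)
  next
    fix x r assume "x \<in> \<Union>\<C>" "r \<in> carrier R"
    then show "x \<otimes> r \<in> \<Union>\<C>"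
      using ri right_ideal.I_r_closed by (metis UnionE UnionI)
  qed
qed

section \<open>Semisimple rings\<close>

context semisimple_ring
begin

text \<open>Split the identity as \<open>e \<oplus> k\<close> along \<open>I\<close> and a
  complement \<open>K\<close>. For \<open>x\<close> in \<open>I\<close>, the element
  \<open>k \<otimes> x = x \<ominus> e \<otimes> x\<close> lies in both summands and hence
  vanishes.\<close>

lemma right_ideal_left_identity:
  assumes "right_ideal I R"
  obtains e where "e \<in> I" "\<And>x. x \<in> I \<Longrightarrow> e \<otimes> x = x"
proof -
  interpret I: right_ideal I R by fact
  obtain K where K: "right_ideal K R" "I <+> K = carrier R" "I \<inter> K = {\<zero>}"
    using right_ideal_complemented[OF assms] by blast
  interpret K: right_ideal K R by fact
  obtain e k where ek: "e \<in> I" "k \<in> K" "\<one> = e \<oplus> k"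
    using K(2) one_closed unfolding set_add_def' by blast
  have "e \<otimes> x = x" if "x \<in> I" for x
  proof -
    have c: "x \<in> carrier R" "e \<in> carrier R" "k \<in> carrier R"
      using that ek I.mem_carrier K.mem_carrier by auto
    have "(e \<oplus> k) \<otimes> x = x"
      using c ek(3) l_one by metis
    moreover have "(e \<oplus> k) \<otimes> x \<ominus> e \<otimes> x = k \<otimes> x"
      using c by algebra
    ultimately have "k \<otimes> x = x \<ominus> e \<otimes> x"
      by simp
    moreover have "k \<otimes> x \<in> K" "x \<ominus> e \<otimes> x \<in> I"
      using that ek c I.I_r_closed K.I_r_closed I.minus_closed_ideal by auto
    ultimately have "x \<ominus> e \<otimes> x = \<zero>"
      using K(3) by auto
    then show ?thesis
      using c by (simp add: minus_eq_zero_iff)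
  qed
  with ek that show thesis by blast
qed

text \<open>The left identity of the principal right ideal of \<open>a\<close> has the form
  \<open>a \<otimes> b\<close>, and it fixes \<open>a\<close>.\<close>

lemma von_Neumann_regular:
  assumes "a \<in> carrier R"
  obtains b where "b \<in> carrier R" "a \<otimes> b \<otimes> a = a"
proof -
  obtain e where e: "e \<in> {a \<otimes> r |r. r \<in> carrier R}"
      "\<And>x. x \<in> {a \<otimes> r |r. r \<in> carrier R} \<Longrightarrow> e \<otimes> x = x"
    using right_ideal_left_identity[OF right_ideal_principal[OF assms]] by blast
  moreover have "a \<in> {a \<otimes> r |r. r \<in> carrier R}"
    using assms by (force intro: exI[of _ \<one>])
  ultimately show thesis
    using that by auto
qed

text \<open>The ascending chain condition, phrased through maximal members. The union of a chain has
  a left identity \<open>e\<close>; a member containing \<open>e\<close> contains every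
  \<open>x = e \<otimes> x\<close> of the union.\<close>

lemma exists_maximal_right_ideal_in:
  assumes "\<A> \<noteq> {}" "\<And>I. I \<in> \<A> \<Longrightarrow> right_ideal I R"
  shows "\<exists>M\<in>\<A>. \<forall>X\<in>\<A>. M \<subseteq> X \<longrightarrow> X = M"
proof (rule subset_Zorn_nonempty[OF assms(1)])
  fix \<C> assume \<C>: "\<C> \<noteq> {}" "subset.chain \<A> \<C>"
  then have U: "right_ideal (\<Union>\<C>) R"
    using right_ideal_Union_chain assms(2) by blast
  obtain e where e: "e \<in> \<Union>\<C>" "\<And>x. x \<in> \<Union>\<C> \<Longrightarrow> e \<otimes> x = x"
    using right_ideal_left_identity[OF U] by blast
  obtain I where I: "I \<in> \<C>" "e \<in> I"
    using e(1) by blast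
  then have "I \<in> \<A>"
    using \<C>(2) by (auto simp: subset_chain_def)
  then interpret I: right_ideal I R
    by (rule assms(2))
  have "\<Union>\<C> \<subseteq> I"
    using e(2) I(2) I.I_r_closed right_ideal.mem_carrier[OF U] by (metis subsetI)
  then have "\<Union>\<C> = I"
    using I(1) by blast
  then show "\<Union>\<C> \<in> \<A>"
    using \<open>I \<in> \<A>\<close> by simp
qed

section \<open>Dedekind finiteness and unit-regularity of semisimple rings\<close>

text \<open>The right annihilators \<open>N n\<close> of the powers of \<open>x\<close> become
  stationary at some \<open>n\<close>. The element \<open>s = \<one> \<ominus> y \<otimes> x\<close>
  satisfies \<open>x \<otimes> s = \<zero>\<close> and
  \<open>s = x [^] n \<otimes> (y [^] n \<otimes> s)\<close>, so \<open>y [^] n \<otimes> s\<close>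
  lies in \<open>N (Suc n) = N n\<close>, which means \<open>s = \<zero>\<close>.\<close>

lemma right_inverse_imp_left_inverse:
  assumes x: "x \<in> carrier R" and y: "y \<in> carrier R" and xy: "x \<otimes> y = \<one>"
  shows "y \<otimes> x = \<one>"
proof -
  define N where "N n = {s \<in> carrier R. x [^] n \<otimes> s = \<zero>}" for n :: nat
  have ri: "right_ideal (N n) R" for n
    using x by (intro right_idealI) (auto simp: N_def r_distr m_assoc[symmetric])
  have "\<exists>M\<in>range N. \<forall>X\<in>range N. M \<subseteq> X \<longrightarrow> X = M"
    by (rule exists_maximal_right_ideal_in) (use ri in auto)
  then have "\<exists>n. \<forall>m. N n \<subseteq> N m \<longrightarrow> N m = N n"
    by simp
  then obtain n where max: "\<forall>m. N n \<subseteq> N m \<longrightarrow> N m = N n" ..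
  have pow_Suc: "x [^] Suc n \<otimes> s = x \<otimes> (x [^] n \<otimes> s)" if "s \<in> carrier R" for s
    using that x nat_pow_Suc2[OF x, of n] by (simp only: m_assoc nat_pow_closed)
  have "N n \<subseteq> N (Suc n)"
    using x pow_Suc by (simp add: N_def subset_iff del: nat_pow_Suc)
  then have eq: "N (Suc n) = N n"
    using max by blast
  have pow: "x [^] m \<otimes> y [^] m = \<one>" for m :: nat
  proof (induction m)
    case (Suc m)
    have "x [^] Suc m \<otimes> y [^] Suc m = x [^] m \<otimes> (x \<otimes> y) \<otimes> y [^] m"
      unfolding nat_pow_Suc2[OF y] using x y by (simp add: m_assoc)
    then show ?case
      using Suc x y xy by simp
  qed simp
  define s where "s = \<one> \<ominus> y \<otimes> x"
  have s: "s \<in> carrier R"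
    using x y by (simp add: s_def)
  have "x \<otimes> s = x \<ominus> x \<otimes> y \<otimes> x"
    unfolding s_def using x y by (simp add: complement_mult m_assoc)
  then have xs: "x \<otimes> s = \<zero>"
    using x xy by (simp add: minus_eq_zero_iff)
  have pows: "x [^] n \<otimes> (y [^] n \<otimes> s) = s"
    using x y s by (simp add: mult_eq_extend[OF pow])
  then have "y [^] n \<otimes> s \<in> N (Suc n)"
    using x y s xs pow_Suc by (simp add: N_def del: nat_pow_Suc)
  then have "y [^] n \<otimes> s \<in> N n"
    unfolding eq .
  then have "s = \<zero>"
    using pows by (simp add: N_def)
  then show ?thesis
    using x y by (auto simp: s_def minus_eq_zero_iff)
qed

text \<open>A left identity \<open>z\<close> of \<open>I\<close> is already central: the commutator
  \<open>m\<close> of \<open>z\<close> with any \<open>r\<close> lies in \<open>I\<close> and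
  satisfies \<open>m \<otimes> z = \<zero>\<close>, and regularity of \<open>m\<close> then forces
  \<open>m = \<zero>\<close>.\<close>

lemma two_sided_ideal_central_identity:
  assumes "right_ideal I R" and l: "\<And>r s. \<lbrakk>s \<in> I; r \<in> carrier R\<rbrakk> \<Longrightarrow> r \<otimes> s \<in> I"
  obtains z where "z \<in> I" "\<And>x. x \<in> I \<Longrightarrow> z \<otimes> x = x" "\<And>r. r \<in> carrier R \<Longrightarrow> z \<otimes> r = r \<otimes> z"
proof -
  interpret I: right_ideal I R by fact
  obtain z where z: "z \<in> I" "\<And>x. x \<in> I \<Longrightarrow> z \<otimes> x = x"
    using right_ideal_left_identity[OF assms(1)] by blast
  have zc: "z \<in> carrier R"
    using z(1) I.mem_carrier by blast
  have zz: "z \<otimes> z = z"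
    using z by blast
  have zrz: "z \<otimes> (r \<otimes> z) = r \<otimes> z" if "r \<in> carrier R" for r
    using that z l by blast
  have "z \<otimes> r = r \<otimes> z" if r: "r \<in> carrier R" for r
  proof -
    define m where "m = z \<otimes> r \<ominus> r \<otimes> z"
    have m: "m \<in> carrier R"
      using r zc by (simp add: m_def)
    have mz: "m \<otimes> z = \<zero>"
    proof -
      have "m \<otimes> z = z \<otimes> (r \<otimes> z) \<ominus> r \<otimes> (z \<otimes> z)"
        unfolding m_def using r zc by algebra
      then show ?thesis
        using r zc zz zrz by (simp add: minus_eq_zero_iff)
    qed
    have zm: "z \<otimes> m = m"
      by (rule z(2)) (use r z(1) l I.I_r_closed I.minus_closed_ideal in \<open>simp add: m_def\<close>)
    obtain x where x: "x \<in> carrier R" "m \<otimes> x \<otimes> m = m"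
      using von_Neumann_regular[OF m] by blast
    \<comment> \<open>The middle factor \<open>x\<close> becomes \<open>x \<otimes> z\<close>
      because \<open>z \<otimes> m = m\<close>, and then \<open>z \<otimes> (x \<otimes> z)\<close>
      because \<open>x \<otimes> z\<close> lies in \<open>I\<close>; this exposes
      \<open>m \<otimes> z = \<zero>\<close>.\<close>
    have "m \<otimes> x \<otimes> m = m \<otimes> (x \<otimes> (z \<otimes> m))"
      using m x(1) zm by (simp add: m_assoc)
    also have "\<dots> = m \<otimes> (x \<otimes> z) \<otimes> m"
      using m x(1) zc by (simp add: m_assoc)
    also have "\<dots> = m \<otimes> (z \<otimes> (x \<otimes> z)) \<otimes> m"
      using x(1) by (simp add: zrz)
    also have "\<dots> = (m \<otimes> z) \<otimes> (x \<otimes> z) \<otimes> m"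
      using m x(1) zc by (simp add: m_assoc)
    finally have "m = \<zero>"
      using m x zc mz by simp
    then show ?thesis
      using r zc by (simp add: m_def minus_eq_zero_iff)
  qed
  with z that show thesis by blast
qed

text \<open>
  Isomorphic idempotents have isomorphic complements: enlarge the partial inverses
  \<open>t \<otimes> b \<otimes> t\<close> and \<open>b\<close> to a maximal pair. The complementary idempotents \<open>p\<close> and \<open>q\<close> that are left
  satisfy \<open>q R p = 0\<close>, so a central idempotent separates them, and Dedekind finiteness gives
  \<open>p = 0\<close> and then \<open>q = 0\<close>.
\<close>

lemma unit_partner:
  assumes b: "b \<in> carrier R" and t: "t \<in> carrier R" and btb: "b \<otimes> t \<otimes> b = b"
  obtains x where "x \<in> Units R" "b \<otimes> x = b \<otimes> t"
proof -
  \<comment> \<open>\<open>P x y\<close> makes \<open>x\<close> and \<open>y\<close> inverse to each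
    other between the idempotents \<open>x \<otimes> y\<close> and \<open>y \<otimes> x\<close>,
    fixes the value of \<open>b \<otimes> x\<close>, and makes \<open>x \<otimes> y\<close> a right
    identity for \<open>b\<close>.\<close>
  define P where "P x y \<longleftrightarrow> x \<in> carrier R \<and> y \<in> carrier R \<and> x \<otimes> y \<otimes> x = x \<and>
    y \<otimes> x \<otimes> y = y \<and> b \<otimes> x = b \<otimes> t \<and> b \<otimes> x \<otimes> y = b" for x y
  \<comment> \<open>Pairs are compared through the right ideals generated by
    \<open>x \<otimes> y\<close>, so that the chain condition yields a maximal one.\<close>
  define A where "A = {{x \<otimes> y \<otimes> r |r. r \<in> carrier R} |x y. P x y}"
  have btb': "b \<otimes> (t \<otimes> b) = b" and btb'': "s \<in> carrier R \<Longrightarrow> b \<otimes> (t \<otimes> (b \<otimes> s)) = b \<otimes> s" for s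
    using b t btb mult_eq_extend[of "b \<otimes> t" b b s] by (auto simp: m_assoc)
  have "P (t \<otimes> b \<otimes> t) b"
    using b t unfolding P_def by (simp add: m_assoc btb' btb'')
  then have "A \<noteq> {}"
    by (auto simp: A_def)
  moreover have "right_ideal I R" if "I \<in> A" for I
    using that right_ideal_principal by (auto simp: A_def P_def)
  ultimately have "\<exists>M\<in>A. \<forall>X\<in>A. M \<subseteq> X \<longrightarrow> X = M"
    by (rule exists_maximal_right_ideal_in)
  then obtain M where M: "M \<in> A" "\<forall>I\<in>A. M \<subseteq> I \<longrightarrow> I = M" ..
  then obtain x y where P: "P x y" and M_def: "M = {x \<otimes> y \<otimes> r |r. r \<in> carrier R}"
    by (auto simp: A_def)
  have c: "x \<in> carrier R" "y \<in> carrier R" and x: "x \<otimes> y \<otimes> x = x" and y: "y \<otimes> x \<otimes> y = y"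
      and bx: "b \<otimes> x = b \<otimes> t" and bxy: "b \<otimes> x \<otimes> y = b"
    using P by (auto simp: P_def)
  define p where "p = \<one> \<ominus> y \<otimes> x"
  define q where "q = \<one> \<ominus> x \<otimes> y"
  have pq: "p \<in> carrier R" "q \<in> carrier R"
    using c by (auto simp: p_def q_def)
  have "y \<otimes> x \<otimes> (y \<otimes> x) = y \<otimes> x" "x \<otimes> y \<otimes> (x \<otimes> y) = x \<otimes> y"
    using c x y by (simp_all add: m_assoc[symmetric])
  then have pp: "p \<otimes> p = p" and qq: "q \<otimes> q = q"
    using c unfolding p_def q_def by (simp_all add: complement_idempotent)
  have zeros: "x \<otimes> p = \<zero>" "p \<otimes> y = \<zero>" "y \<otimes> q = \<zero>" "q \<otimes> x = \<zero>" "b \<otimes> q = \<zero>"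
    using b c x y bxy unfolding p_def q_def
    by (simp_all add: complement_mult minus_eq_zero_iff m_assoc)
  \<comment> \<open>A nonzero \<open>n = q \<otimes> s \<otimes> p\<close> with partial inverse
    \<open>m\<close> would enlarge the pair to \<open>x \<oplus> n\<close>,
    \<open>y \<oplus> m\<close>, against maximality.\<close>
  have qsp: "q \<otimes> (s \<otimes> p) = \<zero>" if s: "s \<in> carrier R" for s
  proof -
    define n where "n = q \<otimes> s \<otimes> p"
    have n: "n \<in> carrier R" "q \<otimes> n = n" "n \<otimes> p = n"
      unfolding n_def using s pq qq pp by (simp_all add: m_assoc mult_eq_extend[OF qq])
    obtain m0 where m0: "m0 \<in> carrier R" "n \<otimes> m0 \<otimes> n = n"
      using von_Neumann_regular[OF n(1)] by blast
    \<comment> \<open>\<open>m0 \<otimes> n \<otimes> m0\<close> satisfies both quasi-inverse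
      equations with \<open>n\<close>. Cutting it by \<open>p\<close> and \<open>q\<close> preserves
      them, as \<open>n\<close> is fixed by \<open>q\<close> on the left and by \<open>p\<close> on
      the right, and makes \<open>x \<otimes> m\<close> and \<open>m \<otimes> x\<close>
      vanish.\<close>
    define m where "m = p \<otimes> (m0 \<otimes> n \<otimes> m0) \<otimes> q"
    have m: "m \<in> carrier R" "p \<otimes> m = m" "m \<otimes> q = m"
      unfolding m_def using m0 n pq qq pp by (simp_all add: m_assoc mult_eq_extend[OF pp])
    have e: "n \<otimes> (m0 \<otimes> n) = n" "n \<otimes> (m0 \<otimes> (n \<otimes> s)) = n \<otimes> s" if "s \<in> carrier R" for s
      using m0 n(1) that mult_eq_extend[of "n \<otimes> m0" n n s] by (auto simp: m_assoc)
    note n' = mult_eq_extend[OF n(2)] mult_eq_extend[OF n(3)]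
    have nmn: "n \<otimes> m \<otimes> n = n"
      unfolding m_def using m0(1) n pq by (simp add: m_assoc n' e)
    have mnm: "m \<otimes> n \<otimes> m = m"
      unfolding m_def using m0(1) n pq by (simp add: m_assoc n' e)
    have "x \<otimes> m = (x \<otimes> p) \<otimes> m" "n \<otimes> y = n \<otimes> (p \<otimes> y)" "y \<otimes> n = (y \<otimes> q) \<otimes> n"
        "m \<otimes> x = m \<otimes> (q \<otimes> x)" "b \<otimes> n = (b \<otimes> q) \<otimes> n"
      using b c m n pq by (metis m_assoc)+
    then have z: "x \<otimes> m = \<zero>" "n \<otimes> y = \<zero>" "y \<otimes> n = \<zero>" "m \<otimes> x = \<zero>" "b \<otimes> n = \<zero>"
      using zeros m n by auto
    have z': "x \<otimes> (m \<otimes> s) = \<zero>" "n \<otimes> (y \<otimes> s) = \<zero>" "y \<otimes> (n \<otimes> s) = \<zero>"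
        "m \<otimes> (x \<otimes> s) = \<zero>" "b \<otimes> (n \<otimes> s) = \<zero>" if "s \<in> carrier R" for s
      using that b c m n by (simp_all add: z[THEN mult_eq_extend])
    have xyn: "(x \<oplus> n) \<otimes> (y \<oplus> m) = x \<otimes> y \<oplus> n \<otimes> m"
      using c m(1) n(1) z by (simp add: l_distr r_distr)
    have "b \<otimes> (t \<otimes> m) = \<zero>"
      using b t c m(1) z(1) m_assoc[of b x m] m_assoc[of b t m] bx by simp
    then have "P (x \<oplus> n) (y \<oplus> m)"
      using b t c m(1) n(1) z z' x y bx bxy nmn mnm
      by (simp add: P_def l_distr r_distr m_assoc)
    then have "{(x \<otimes> y \<oplus> n \<otimes> m) \<otimes> r |r. r \<in> carrier R} \<in> A" (is "?N \<in> A")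
      unfolding A_def xyn[symmetric] by (intro CollectI exI conjI) (rule refl)
    moreover have "M \<subseteq> ?N"
    proof
      fix v assume "v \<in> M"
      then obtain r where r: "r \<in> carrier R" "v = x \<otimes> y \<otimes> r"
        by (auto simp: M_def)
      have "(x \<otimes> y \<oplus> n \<otimes> m) \<otimes> (x \<otimes> y \<otimes> r) = x \<otimes> y \<otimes> x \<otimes> y \<otimes> r"
        using c m(1) n(1) r z' by (simp add: l_distr m_assoc)
      then show "v \<in> ?N"
        using r c x by (auto intro!: exI[of _ "x \<otimes> y \<otimes> r"])
    qed
    ultimately have "?N = M"
      using M(2) by simp
    moreover have "(x \<otimes> y \<oplus> n \<otimes> m) \<otimes> n = n"
      using c m(1) n(1) z z' nmn by (simp add: l_distr m_assoc)
    then have "n \<in> ?N"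
      using n(1) by force
    \<comment> \<open>By maximality \<open>n\<close> lies in the right ideal of
      \<open>x \<otimes> y\<close>; since \<open>q\<close> fixes \<open>n\<close> but annihilates
      \<open>x\<close>, it follows that \<open>n = \<zero>\<close>.\<close>
    ultimately obtain r where r: "r \<in> carrier R" "n = x \<otimes> y \<otimes> r"
      by (auto simp: M_def)
    then have "n = q \<otimes> x \<otimes> y \<otimes> r"
      using n(2) c pq by (simp add: m_assoc)
    then show ?thesis
      using r c pq s zeros by (simp add: n_def m_assoc)
  qed
  \<comment> \<open>The right annihilator of the right ideal \<open>q R\<close> is two-sided, and by
    \<open>qsp\<close> it contains \<open>p\<close>. Its central identity \<open>z\<close> is the
    separating idempotent: \<open>q \<otimes> z = \<zero>\<close> and
    \<open>z \<otimes> p = p\<close>.\<close>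
  define I where "I = {s \<in> carrier R. \<forall>r\<in>carrier R. q \<otimes> (r \<otimes> s) = \<zero>}"
  have I: "right_ideal I R"
    using pq by (intro right_idealI) (auto simp: I_def r_distr m_assoc[symmetric])
  moreover have "r \<otimes> s \<in> I" if "s \<in> I" "r \<in> carrier R" for r s
    using that pq by (simp add: I_def) (metis m_assoc m_closed)
  ultimately obtain z where z: "z \<in> I" "\<And>v. v \<in> I \<Longrightarrow> z \<otimes> v = v"
      and zc: "\<And>r. r \<in> carrier R \<Longrightarrow> z \<otimes> r = r \<otimes> z"
    using two_sided_ideal_central_identity by blast
  have zR: "z \<in> carrier R"
    using z(1) by (simp add: I_def)
  have "q \<otimes> (\<one> \<otimes> z) = \<zero>"
    using z(1) one_closed by (simp only: I_def mem_Collect_eq)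
  then have qz: "q \<otimes> z = \<zero>"
    using zR by simp
  have "p \<in> I"
    using pq qsp by (simp add: I_def)
  then have zp: "z \<otimes> p = p"
    by (rule z)
  have zz: "z \<otimes> z = z"
    using z by blast
  have "q \<otimes> z = z \<ominus> x \<otimes> y \<otimes> z"
    unfolding q_def using c zR by (simp add: complement_mult)
  then have xyz: "x \<otimes> y \<otimes> z = z"
    using qz c zR by (metis m_closed minus_eq_zero_iff)
  have zz': "(\<one> \<ominus> z) \<otimes> (\<one> \<ominus> z) = \<one> \<ominus> z" "z \<otimes> (\<one> \<ominus> z) = \<zero>" "(\<one> \<ominus> z) \<otimes> z = \<zero>"
    using zR zz complement_idempotent by auto
  \<comment> \<open>Padding with \<open>\<one> \<ominus> z\<close> carries products in the factor
    \<open>R z\<close>, whose identity is \<open>z\<close>, to products in the whole ring, where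
    Dedekind finiteness applies.\<close>
  have conj_z: "(v \<otimes> z \<oplus> (\<one> \<ominus> z)) \<otimes> (w \<otimes> z \<oplus> (\<one> \<ominus> z)) = v \<otimes> w \<otimes> z \<oplus> (\<one> \<ominus> z)"
    if vw: "v \<in> carrier R" "w \<in> carrier R" for v w
  proof -
    have "z \<otimes> (w \<otimes> z) = w \<otimes> z"
      using vw zR zz zc[of w] by (metis m_assoc)
    moreover have "(\<one> \<ominus> z) \<otimes> (w \<otimes> z) = \<zero>"
      using vw zR calculation by (simp add: complement_mult minus_eq_zero_iff)
    ultimately show ?thesis
      using vw zR zz' by (simp add: l_distr r_distr m_assoc)
  qed
  have one: "z \<oplus> (\<one> \<ominus> z) = \<one>"
    using zR by algebra
  \<comment> \<open>Since \<open>q \<otimes> z = \<zero>\<close>, the product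
    \<open>x \<otimes> y\<close> acts as the identity on the factor of \<open>z\<close>; hence so
    does \<open>y \<otimes> x\<close>, which gives \<open>p \<otimes> z = \<zero>\<close>, while
    \<open>p = z \<otimes> p = p \<otimes> z\<close>.\<close>
  have "(x \<otimes> z \<oplus> (\<one> \<ominus> z)) \<otimes> (y \<otimes> z \<oplus> (\<one> \<ominus> z)) = \<one>"
    using conj_z[OF c] xyz one by simp
  then have "(y \<otimes> z \<oplus> (\<one> \<ominus> z)) \<otimes> (x \<otimes> z \<oplus> (\<one> \<ominus> z)) = \<one>"
    using right_inverse_imp_left_inverse c zR by simp
  then have "y \<otimes> x \<otimes> z \<oplus> (\<one> \<ominus> z) = \<one>"
    using conj_z c by simp
  then have "y \<otimes> x \<otimes> z \<oplus> (\<one> \<ominus> z) = z \<oplus> (\<one> \<ominus> z)"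
    using one by simp
  then have "y \<otimes> x \<otimes> z = z"
    using c zR by simp
  then have "p \<otimes> z = \<zero>"
    unfolding p_def using c zR by (simp add: complement_mult minus_eq_zero_iff)
  then have "p = \<zero>"
    using zp zc pq by simp
  then have yx: "y \<otimes> x = \<one>"
    using c by (auto simp: p_def minus_eq_zero_iff)
  then have "x \<otimes> y = \<one>"
    using right_inverse_imp_left_inverse c by blast
  then have "x \<in> Units R"
    using c yx by (auto simp: Units_def)
  with bx that show thesis by blast
qed

end

lemma regular_elementI:
  assumes "a \<in> carrier R" "b \<in> carrier R" "a \<otimes>\<^bsub>R\<^esub> b \<otimes>\<^bsub>R\<^esub> a = a"
  shows "regular_element R a"
  using assms unfolding regular_element_def by metis

lemma regular_elementE:
  assumes "regular_element R a"
  obtains b where "b \<in> carrier R" "a \<otimes>\<^bsub>R\<^esub> b \<otimes>\<^bsub>R\<^esub> a = a"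
  using assms unfolding regular_element_def by metis

section \<open>The Jacobson radical\<close>

context ring
begin

lemma radical_closed: "x \<in> jacobson_radical R \<Longrightarrow> x \<in> carrier R"
  by (simp add: jacobson_radical_def)

lemma radical_right_ideal: "right_ideal (jacobson_radical R) R"
proof (rule right_idealI)
  show "\<zero> \<in> jacobson_radical R"
    by (auto simp: jacobson_radical_def maximal_right_ideal_def right_ideal_def
        intro: additive_subgroup.zero_closed)
next
  fix x y assume "x \<in> jacobson_radical R" "y \<in> jacobson_radical R"
  then show "x \<oplus> y \<in> jacobson_radical R"
    by (auto simp: jacobson_radical_def maximal_right_ideal_def right_ideal_def
        intro: additive_subgroup.a_closed)
next
  fix x r assume "x \<in> jacobson_radical R" "r \<in> carrier R"
  then show "x \<otimes> r \<in> jacobson_radical R"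
    by (auto simp: jacobson_radical_def maximal_right_ideal_def intro: right_ideal.I_r_closed)
qed (auto simp: jacobson_radical_def)

text \<open>Zorn's lemma among the right ideals that contain \<open>I\<close> and omit
  \<open>\<one>\<close>. Omitting \<open>\<one>\<close> means being proper, and it passes to unions
  of chains.\<close>

lemma exists_maximal_right_ideal:
  assumes I: "right_ideal I R" "\<one> \<notin> I"
  shows "\<exists>M. maximal_right_ideal M R \<and> I \<subseteq> M"
proof -
  define \<A> where "\<A> = {K. right_ideal K R \<and> I \<subseteq> K \<and> \<one> \<notin> K}"
  have "\<exists>M\<in>\<A>. \<forall>X\<in>\<A>. M \<subseteq> X \<longrightarrow> X = M"
  proof (rule subset_Zorn_nonempty)
    show "\<A> \<noteq> {}"
      using I by (auto simp: \<A>_def)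
    fix \<C> assume \<C>: "\<C> \<noteq> {}" "subset.chain \<A> \<C>"
    have "right_ideal (\<Union>\<C>) R"
      by (rule right_ideal_Union_chain[OF \<C>]) (simp add: \<A>_def)
    moreover have "\<C> \<subseteq> \<A>"
      using \<C>(2) by (simp add: subset_chain_def)
    ultimately show "\<Union>\<C> \<in> \<A>"
      using \<C>(1) unfolding \<A>_def by blast
  qed
  then obtain M where M: "M \<in> \<A>" and max: "\<forall>X\<in>\<A>. M \<subseteq> X \<longrightarrow> X = M" ..
  have Mr: "right_ideal M R" "I \<subseteq> M" "\<one> \<notin> M"
    using M by (auto simp: \<A>_def)
  have "maximal_right_ideal M R"
  proof (intro maximal_right_ideal.intro maximal_right_ideal_axioms.intro Mr(1))
    show "carrier R \<noteq> M"
      using Mr(3) one_closed by blast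
    fix J assume J: "right_ideal J R" "M \<subseteq> J" "J \<subseteq> carrier R"
    show "J = M \<or> J = carrier R"
    proof (cases "\<one> \<in> J")
      case True
      then have "carrier R \<subseteq> J"
        using right_ideal.I_r_closed[OF J(1) True] by force
      then show ?thesis
        using J(3) by blast
    next
      case False
      then have "J \<in> \<A>"
        using J Mr(2) by (auto simp: \<A>_def)
      then show ?thesis
        using max J(2) by blast
    qed
  qed
  then show ?thesis
    using Mr(2) by blast
qed

text \<open>Otherwise the right ideal generated by \<open>\<one> \<ominus> j\<close> lies in a
  maximal right ideal, which also contains \<open>j\<close> and therefore
  \<open>\<one>\<close>.\<close>

lemma radical_right_quasiregular:
  assumes j: "j \<in> jacobson_radical R"
  obtains u where "u \<in> carrier R" "(\<one> \<ominus> j) \<otimes> u = \<one>"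
proof -
  have c: "\<one> \<ominus> j \<in> carrier R"
    using j radical_closed by simp
  have "\<one> \<in> {(\<one> \<ominus> j) \<otimes> r |r. r \<in> carrier R}" (is "_ \<in> ?I")
  proof (rule ccontr)
    assume "\<one> \<notin> ?I"
    then obtain M where M: "maximal_right_ideal M R" "?I \<subseteq> M"
      using exists_maximal_right_ideal[OF right_ideal_principal[OF c]] by blast
    then interpret M: maximal_right_ideal M R
      by simp
    have "(\<one> \<ominus> j) \<otimes> \<one> \<in> ?I"
      by blast
    then have "\<one> \<ominus> j \<in> M"
      using M(2) c by auto
    moreover have "j \<in> M"
      using j M(1) by (simp add: jacobson_radical_def)
    ultimately have "(\<one> \<ominus> j) \<oplus> j \<in> M"
      by blast
    moreover have "(\<one> \<ominus> j) \<oplus> j = \<one>"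
      using radical_closed[OF j] by (simp add: minus_eq a_assoc l_neg)
    ultimately have "\<one> \<in> M"
      by simp
    then have "carrier R \<subseteq> M"
      using M.I_r_closed by force
    then show False
      using M.I_notcarr M.a_subset by blast
  qed
  with that show thesis
    by auto
qed

text \<open>For closure under left multiplication, suppose \<open>r \<otimes> j\<close> is outside a
  maximal right ideal \<open>M\<close>. Then \<open>M\<close> and \<open>r \<otimes> j\<close>
  together generate the whole ring, in particular \<open>r\<close>, and quasiregularity pulls
  \<open>r\<close>, hence \<open>r \<otimes> j\<close>, back into \<open>M\<close>.\<close>

lemma radical_ideal: "ideal (jacobson_radical R) R"
proof -
  interpret J: right_ideal "jacobson_radical R" R
    by (rule radical_right_ideal)
  have "r \<otimes> j \<in> jacobson_radical R" if j: "j \<in> jacobson_radical R" and r: "r \<in> carrier R" for j r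
  proof -
    have jc: "j \<in> carrier R"
      using j radical_closed by blast
    have "r \<otimes> j \<in> M" if M: "maximal_right_ideal M R" for M
    proof (rule ccontr)
      assume notin: "r \<otimes> j \<notin> M"
      interpret M: maximal_right_ideal M R by fact
      define K where "K = {m \<oplus> r \<otimes> j \<otimes> s |m s. m \<in> M \<and> s \<in> carrier R}"
      have KI: "m \<oplus> r \<otimes> j \<otimes> s \<in> K" if "m \<in> M" "s \<in> carrier R" for m s
        using that by (auto simp: K_def)
      have Mc: "m \<in> carrier R" if "m \<in> M" for m
        using that M.a_subset by blast
      have K: "right_ideal K R"
      proof (rule right_idealI)
        show "K \<subseteq> carrier R"
          using Mc jc r by (auto simp: K_def)
        show "\<zero> \<in> K"
          using KI[OF M.zero_closed zero_closed] jc r by simp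
      next
        fix x y assume "x \<in> K" "y \<in> K"
        then obtain m s m' s' where *: "m \<in> M" "s \<in> carrier R" "m' \<in> M" "s' \<in> carrier R"
          and xy: "x = m \<oplus> r \<otimes> j \<otimes> s" "y = m' \<oplus> r \<otimes> j \<otimes> s'"
          by (auto simp: K_def)
        have "x \<oplus> y = (m \<oplus> m') \<oplus> r \<otimes> j \<otimes> (s \<oplus> s')"
          unfolding xy using * Mc jc r by (simp add: r_distr a_ac)
        then show "x \<oplus> y \<in> K"
          using KI * by simp
      next
        fix x t assume "x \<in> K" and t: "t \<in> carrier R"
        then obtain m s where *: "m \<in> M" "s \<in> carrier R" and x: "x = m \<oplus> r \<otimes> j \<otimes> s"
          by (auto simp: K_def)
        have "x \<otimes> t = m \<otimes> t \<oplus> r \<otimes> j \<otimes> (s \<otimes> t)"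
          unfolding x using * Mc jc r t by (simp add: l_distr m_assoc)
        then show "x \<otimes> t \<in> K"
          using KI * t M.I_r_closed by simp
      qed
      have "M \<subseteq> K"
        using KI[OF _ zero_closed] Mc jc r by fastforce
      moreover have "r \<otimes> j \<in> K"
        using KI[OF M.zero_closed one_closed] jc r by simp
      moreover have "K \<subseteq> carrier R"
        using Mc jc r by (auto simp: K_def)
      ultimately have "r \<in> K"
        using M.I_maximal[OF K] notin r by blast
      then obtain m s where ms: "m \<in> M" "s \<in> carrier R" "r = m \<oplus> r \<otimes> j \<otimes> s"
        unfolding K_def by blast
      \<comment> \<open>Solving for \<open>m\<close> isolates the factor
        \<open>\<one> \<ominus> j \<otimes> s\<close>, which has a right inverse \<open>u\<close>;
        thus \<open>r = m \<otimes> u\<close> lies in \<open>M\<close>.\<close>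
      have m: "m = r \<otimes> (\<one> \<ominus> j \<otimes> s)"
      proof -
        have "r \<otimes> (\<one> \<ominus> j \<otimes> s) = r \<ominus> r \<otimes> j \<otimes> s"
          using r jc ms(2) by (simp add: complement_mult m_assoc)
        also have "\<dots> = (m \<oplus> r \<otimes> j \<otimes> s) \<ominus> r \<otimes> j \<otimes> s"
          by (rule arg_cong[OF ms(3)])
        also have "\<dots> = m"
          using ms(1,2) Mc r jc by (simp add: minus_eq a_assoc r_neg)
        finally show ?thesis ..
      qed
      obtain u where u: "u \<in> carrier R" "(\<one> \<ominus> j \<otimes> s) \<otimes> u = \<one>"
        using radical_right_quasiregular j ms(2) J.I_r_closed by metis
      have "m \<otimes> u = r \<otimes> ((\<one> \<ominus> j \<otimes> s) \<otimes> u)"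
        unfolding m using r jc ms(2) u(1) by (simp add: m_assoc)
      then have "m \<otimes> u = r"
        using r u by simp
      then have "r \<in> M"
        using M.I_r_closed[OF ms(1) u(1)] by simp
      then show False
        using notin M.I_r_closed jc by blast
    qed
    then show ?thesis
      unfolding jacobson_radical_def using m_closed[OF r jc] by blast
  qed
  then show ?thesis
    by (intro ideal.intro ideal_axioms.intro J.is_additive_subgroup ring_axioms)
      (blast intro: J.I_r_closed)+
qed

text \<open>The right inverse \<open>u\<close> equals \<open>\<one> \<oplus> j \<otimes> u\<close>,
  so it has a right inverse in turn; as \<open>\<one> \<ominus> j\<close> is a left inverse of
  \<open>u\<close>, the two coincide.\<close>

lemma one_minus_radical_unit:
  assumes j: "j \<in> jacobson_radical R"
  shows "\<one> \<ominus> j \<in> Units R"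
proof -
  interpret J: ideal "jacobson_radical R" R
    by (rule radical_ideal)
  have jc: "j \<in> carrier R"
    using j radical_closed by blast
  obtain u where u: "u \<in> carrier R" "(\<one> \<ominus> j) \<otimes> u = \<one>"
    using radical_right_quasiregular[OF j] .
  have "u \<ominus> j \<otimes> u = \<one>"
    using u jc by (simp add: complement_mult)
  moreover have "(u \<ominus> j \<otimes> u) \<oplus> j \<otimes> u = u"
    using u(1) jc by (simp add: minus_eq a_assoc l_neg)
  ultimately have "\<one> \<ominus> \<ominus> (j \<otimes> u) = u"
    using u(1) jc by (simp add: minus_eq)
  moreover have "\<ominus> (j \<otimes> u) \<in> jacobson_radical R"
    using j u J.I_r_closed by simp
  ultimately obtain v where v: "v \<in> carrier R" "u \<otimes> v = \<one>"
    using radical_right_quasiregular[of "\<ominus> (j \<otimes> u)"] by auto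
  have "\<one> \<ominus> j = v"
    by (rule inv_unique[OF u(2) v(2)]) (use u v jc in auto)
  then show ?thesis
    using u v jc by (auto simp: Units_def)
qed

lemma one_plus_radical_unit:
  assumes "j \<in> jacobson_radical R"
  shows "\<one> \<oplus> j \<in> Units R"
proof -
  interpret J: ideal "jacobson_radical R" R
    by (rule radical_ideal)
  have "\<one> \<ominus> \<ominus> j \<in> Units R"
    by (rule one_minus_radical_unit) (rule J.a_inv_closed[OF assms])
  moreover have "\<one> \<ominus> \<ominus> j = \<one> \<oplus> j"
    using radical_closed[OF assms] by (simp add: minus_eq)
  ultimately show ?thesis
    by simp
qed

text \<open>From \<open>j = j \<otimes> b \<otimes> j\<close> comes
  \<open>j \<otimes> (\<one> \<ominus> b \<otimes> j) = \<zero>\<close>, whose second factor is a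
  unit.\<close>

lemma radical_regular_zero:
  assumes j: "j \<in> jacobson_radical R" and reg: "regular_element R j"
  shows "j = \<zero>"
proof -
  interpret J: ideal "jacobson_radical R" R
    by (rule radical_ideal)
  obtain b where b: "b \<in> carrier R" "j \<otimes> b \<otimes> j = j"
    using reg by (rule regular_elementE)
  have jc: "j \<in> carrier R"
    using j radical_closed by blast
  have un: "\<one> \<ominus> b \<otimes> j \<in> Units R"
    by (rule one_minus_radical_unit) (rule J.I_l_closed[OF j b(1)])
  have "j \<otimes> (\<one> \<ominus> b \<otimes> j) = \<zero>"
    using b jc by (simp add: complement_mult minus_eq_zero_iff m_assoc)
  then have "j \<otimes> (\<one> \<ominus> b \<otimes> j) \<otimes> inv (\<one> \<ominus> b \<otimes> j) = \<zero>"
    using un by simp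
  then have "j \<otimes> ((\<one> \<ominus> b \<otimes> j) \<otimes> inv (\<one> \<ominus> b \<otimes> j)) = \<zero>"
    using jc un by (simp only: m_assoc Units_closed Units_inv_closed)
  then show ?thesis
    using jc un by simp
qed

end

section \<open>Regular elements\<close>

context ring
begin

lemma regular_element_mult_unit_right:
  assumes a: "a \<in> carrier R" and x: "x \<in> Units R" and reg: "regular_element R (a \<otimes> x)"
  shows "regular_element R a"
proof -
  obtain b where b: "b \<in> carrier R" "a \<otimes> x \<otimes> b \<otimes> (a \<otimes> x) = a \<otimes> x"
    using reg by (rule regular_elementE)
  have xc: "x \<in> carrier R"
    using x by blast
  have "a \<otimes> x \<otimes> b \<otimes> (a \<otimes> x) \<otimes> inv x = a \<otimes> x \<otimes> inv x"
    using b(2) by simp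
  then have "a \<otimes> (x \<otimes> b) \<otimes> a = a"
    using a b(1) x xc by (simp add: m_assoc)
  then show ?thesis
    using a b(1) xc by (intro regular_elementI[of a _ "x \<otimes> b"]) auto
qed

lemma regular_element_mult_unit_left:
  assumes a: "a \<in> carrier R" and x: "x \<in> Units R" and reg: "regular_element R (x \<otimes> a)"
  shows "regular_element R a"
proof -
  obtain b where b: "b \<in> carrier R" "x \<otimes> a \<otimes> b \<otimes> (x \<otimes> a) = x \<otimes> a"
    using reg by (rule regular_elementE)
  have xc: "x \<in> carrier R"
    using x by blast
  have "inv x \<otimes> (x \<otimes> a \<otimes> b \<otimes> (x \<otimes> a)) = inv x \<otimes> (x \<otimes> a)"
    using b(2) by simp
  then have "a \<otimes> (b \<otimes> x) \<otimes> a = a"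
    using a b(1) x xc by (simp add: m_assoc[symmetric])
  then show ?thesis
    using a b(1) xc by (intro regular_elementI[of a _ "b \<otimes> x"]) auto
qed

text \<open>As \<open>f\<close> commutes with \<open>c\<close>, cutting
  \<open>c \<otimes> b \<otimes> c = c\<close> by \<open>f\<close> on both sides shows that the same
  \<open>b\<close> serves for the diagonal block \<open>y\<close>.\<close>

lemma regular_element_corner:
  assumes c: "regular_element R c" and f: "f \<in> carrier R" "f \<otimes> f = f"
    and fc: "f \<otimes> c = y" "c \<otimes> f = y"
  shows "regular_element R y"
proof -
  obtain b where b: "b \<in> carrier R" "c \<otimes> b \<otimes> c = c"
    using c by (rule regular_elementE)
  have cc: "c \<in> carrier R"
    using c by (simp add: regular_element_def)
  have "y \<otimes> b \<otimes> y = (f \<otimes> c) \<otimes> b \<otimes> (c \<otimes> f)"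
    using fc by simp
  also have "\<dots> = f \<otimes> (c \<otimes> b \<otimes> c) \<otimes> f"
    using b(1) cc f(1) by (simp add: m_assoc)
  also have "\<dots> = f \<otimes> c \<otimes> f"
    using b(2) by simp
  also have "\<dots> = f \<otimes> (c \<otimes> f)"
    using f(1) cc by (simp add: m_assoc)
  also have "\<dots> = f \<otimes> (f \<otimes> c)"
    using fc by simp
  also have "\<dots> = y"
    using fc(1) mult_eq_extend[OF f(2) f(1) f(1) cc] by simp
  finally have "y \<otimes> b \<otimes> y = y" .
  moreover have "y \<in> carrier R"
    using cc f(1) fc(1) by auto
  ultimately show ?thesis
    using b(1) by (intro regular_elementI)
qed

text \<open>In Peirce blocks for \<open>e\<close> and \<open>\<one> \<ominus> e\<close>, the
  \<open>e\<close> block of \<open>a\<close> is \<open>e\<close> plus a radical element, hence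
  invertible in \<open>e R e\<close>. The Schur complement that remains is a radical element of the
  other corner, which is zero by \<open>corner\<close>.\<close>

lemma regular_element_near_idempotent:
  assumes a: "a \<in> carrier R" and e: "e \<in> carrier R" "e \<otimes> e = e"
    and ae: "a \<ominus> e \<in> jacobson_radical R"
    and corner: "\<And>j. j \<in> jacobson_radical R \<Longrightarrow> (\<one> \<ominus> e) \<otimes> j \<otimes> (\<one> \<ominus> e) = \<zero>"
  shows "regular_element R a"
proof -
  interpret J: ideal "jacobson_radical R" R
    by (rule radical_ideal)
  define j where "j = a \<ominus> e"
  have j: "j \<in> jacobson_radical R" "j \<in> carrier R"
    using a e ae by (auto simp: j_def)
  have a_eq: "a = e \<oplus> j"
    using a e by (simp add: j_def minus_eq a_lcomm r_neg)
  \<comment> \<open>\<open>u\<close> is the block \<open>e \<otimes> a \<otimes> e\<close> padded by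
    \<open>\<one> \<ominus> e\<close>, so that it can be inverted in \<open>R\<close>;
    \<open>k\<close> is then the inverse of the block inside \<open>e R e\<close>.\<close>
  define u where "u = \<one> \<oplus> e \<otimes> j \<otimes> e"
  have u: "u \<in> Units R" "u \<in> carrier R"
    using one_plus_radical_unit[of "e \<otimes> j \<otimes> e"] j e by (auto simp: u_def J.I_l_closed J.I_r_closed)
  note ee = e(2) mult_eq_extend[OF e(2)]
  have eae: "e \<otimes> a \<otimes> e = e \<otimes> u" "e \<otimes> a \<otimes> e = u \<otimes> e"
    unfolding a_eq u_def using e(1) j(2) by (simp_all add: l_distr r_distr m_assoc ee)
  define k where "k = inv u \<otimes> e"
  have kc: "k \<in> carrier R"
    using u e by (simp add: k_def)
  have comm: "inv u \<otimes> e = e \<otimes> inv u"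
  proof -
    have "inv u \<otimes> e = inv u \<otimes> (e \<otimes> u) \<otimes> inv u"
      using u e(1) by (simp add: m_assoc)
    also have "\<dots> = inv u \<otimes> (u \<otimes> e) \<otimes> inv u"
      unfolding eae[symmetric] ..
    also have "\<dots> = e \<otimes> inv u"
      using u e(1) by (simp add: m_assoc[symmetric])
    finally show ?thesis .
  qed
  have "e \<otimes> a \<otimes> k = (e \<otimes> a \<otimes> e) \<otimes> inv u"
    unfolding k_def comm using a e u by (simp add: m_assoc)
  also have "\<dots> = e"
    unfolding eae(1) using e u by (simp add: m_assoc)
  finally have eak: "e \<otimes> a \<otimes> k = e" .
  have "k \<otimes> a \<otimes> e = inv u \<otimes> (e \<otimes> a \<otimes> e)"
    unfolding k_def using a e u by (simp add: m_assoc)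
  also have "\<dots> = e"
    unfolding eae(2) using e u by (simp add: m_assoc[symmetric])
  finally have kae: "k \<otimes> a \<otimes> e = e" .
  \<comment> \<open>\<open>d\<close> measures the failure of \<open>k\<close> to be a quasi-inverse
    of \<open>a\<close>; it is the Schur complement up to sign.\<close>
  define d where "d = a \<otimes> k \<otimes> a \<ominus> a"
  have dc: "d \<in> carrier R"
    using a kc by (simp add: d_def)
  have "e \<otimes> d = e \<otimes> a \<otimes> k \<otimes> a \<ominus> e \<otimes> a" "d \<otimes> e = a \<otimes> (k \<otimes> a \<otimes> e) \<ominus> a \<otimes> e"
    unfolding d_def using a e kc by (simp_all add: minus_eq l_distr r_distr l_minus r_minus m_assoc)
  then have ed: "e \<otimes> d = \<zero>" "d \<otimes> e = \<zero>"
    using a e eak kae by (simp_all add: minus_eq_zero_iff)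
  define f where "f = \<one> \<ominus> e"
  have f: "f \<in> carrier R" "e \<otimes> f = \<zero>"
    using e complement_idempotent by (auto simp: f_def)
  have "d \<ominus> \<zero> = d"
    using dc by (simp add: minus_eq)
  then have df: "d \<otimes> f = d" and fd: "f \<otimes> d = d"
    unfolding f_def using dc e ed by (simp_all add: complement_mult)
  \<comment> \<open>Because \<open>a \<otimes> f = j \<otimes> f\<close>, the last factor
    \<open>a\<close> in \<open>d\<close> may be replaced by \<open>j\<close> before multiplying by
    \<open>f\<close>, which places \<open>d\<close> in the radical.\<close>
  define i where "i = a \<otimes> k \<otimes> j \<ominus> j"
  have i: "i \<in> jacobson_radical R"
    unfolding i_def minus_eq
    by (intro J.a_closed J.a_inv_closed J.I_l_closed[OF j(1) m_closed[OF a kc]] j(1))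
  then have ic: "i \<in> carrier R"
    by (rule radical_closed)
  have af: "a \<otimes> f = j \<otimes> f"
    unfolding a_eq using e j f by (simp add: l_distr)
  have "d \<otimes> f = a \<otimes> k \<otimes> (a \<otimes> f) \<ominus> a \<otimes> f"
    unfolding d_def using a kc f by (simp add: minus_eq l_distr l_minus m_assoc)
  also have "\<dots> = i \<otimes> f"
    unfolding af i_def using a kc f j by (simp add: minus_eq l_distr l_minus m_assoc)
  finally have "d = i \<otimes> f"
    unfolding df .
  then have "d = f \<otimes> (i \<otimes> f)"
    using fd by metis
  also have "\<dots> = f \<otimes> i \<otimes> f"
    using f(1) ic by (simp add: m_assoc)
  also have "\<dots> = \<zero>"
    unfolding f_def by (rule corner[OF i])
  finally have "d = \<zero>" .
  then have "a \<otimes> k \<otimes> a = a"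
    using a kc by (simp add: d_def minus_eq_zero_iff)
  then show ?thesis
    by (rule regular_elementI[OF a kc])
qed

end

section \<open>The VNL condition and the two corners of the radical\<close>

lemma (in VNL_ring) radical_corner_alternative:
  assumes e: "e \<in> carrier R" "e \<otimes> e = e"
    and i: "i \<in> jacobson_radical R" "(\<one> \<ominus> e) \<otimes> i \<otimes> (\<one> \<ominus> e) \<noteq> \<zero>"
    and j: "j \<in> jacobson_radical R"
  shows "e \<otimes> j \<otimes> e = \<zero>"
proof -
  interpret J: ideal "jacobson_radical R" R
    by (rule radical_ideal)
  define f where "f = \<one> \<ominus> e"
  have fc: "f \<in> carrier R" and ff: "f \<otimes> f = f" and ef: "e \<otimes> f = \<zero>" and fe: "f \<otimes> e = \<zero>"
    using e complement_idempotent by (auto simp: f_def)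
  have ic: "i \<in> carrier R" and jc: "j \<in> carrier R"
    using i j by auto
  define p where "p = f \<otimes> i \<otimes> f"
  define q where "q = e \<otimes> j \<otimes> e"
  have pq: "p \<in> jacobson_radical R" "q \<in> jacobson_radical R" "p \<in> carrier R" "q \<in> carrier R"
    using i j e fc by (auto simp: p_def q_def J.I_l_closed J.I_r_closed)
  have fp: "f \<otimes> p = p" "p \<otimes> f = p" "e \<otimes> p = \<zero>" "p \<otimes> e = \<zero>"
    using ic e fc ff ef fe
    by (simp_all add: p_def m_assoc[symmetric]) (simp_all add: m_assoc)
  have eq: "e \<otimes> q = q" "q \<otimes> e = q" "f \<otimes> q = \<zero>" "q \<otimes> f = \<zero>"
    using jc e fc ff ef fe
    by (simp_all add: q_def m_assoc[symmetric]) (simp_all add: m_assoc)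
  \<comment> \<open>\<open>c\<close> is block diagonal with \<open>f\<close> block \<open>p\<close>,
    and \<open>\<one> \<ominus> c\<close> has \<open>e\<close> block \<open>q\<close>. Regularity of
    either passes to its block, and a regular radical element is zero.\<close>
  define c where "c = p \<oplus> (e \<ominus> q)"
  have cc: "c \<in> carrier R"
    using pq e by (simp add: c_def)
  have fc': "f \<otimes> c = p" "c \<otimes> f = p"
    using pq e fc fp eq fe ef by (simp_all add: c_def minus_eq l_distr r_distr l_minus r_minus)
  have "e \<otimes> c = e \<ominus> q" "c \<otimes> e = e \<ominus> q"
    using pq e fp eq by (simp_all add: c_def minus_eq l_distr r_distr l_minus r_minus)
  moreover have "e \<ominus> (e \<ominus> q) = q"
    using pq e by (simp add: minus_eq minus_add r_neg2 a_assoc[symmetric] r_neg)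
  ultimately have ec: "e \<otimes> (\<one> \<ominus> c) = q" "(\<one> \<ominus> c) \<otimes> e = q"
    using e cc by (simp_all add: complement_mult)
  have "\<not> regular_element R c"
    using regular_element_corner[OF _ fc ff fc'] radical_regular_zero[OF pq(1)] i(2)
    unfolding p_def f_def by blast
  then have "regular_element R (\<one> \<ominus> c)"
    using VNL[OF cc] by blast
  then have "regular_element R q"
    by (rule regular_element_corner[OF _ e ec])
  then show ?thesis
    unfolding q_def[symmetric] by (rule radical_regular_zero[OF pq(2)])
qed

section \<open>Semiperfect rings\<close>

context semiperfect_ring
begin

sublocale J: ideal "jacobson_radical R" R
  by (rule radical_ideal)

sublocale Q: semisimple_ring "R Quot jacobson_radical R"
  by (rule semisimple_modulo_radical)

sublocale ring_hom_ring R "R Quot jacobson_radical R" "(+>) (jacobson_radical R)"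
  by (rule J.rcos_ring_hom_ring)

lemma coset_eq_iff:
  assumes "x \<in> carrier R" "y \<in> carrier R"
  shows "jacobson_radical R +> x = jacobson_radical R +> y \<longleftrightarrow> x \<ominus> y \<in> jacobson_radical R"
  by (rule quotient_eq_iff_same_a_r_cos[OF radical_ideal assms, symmetric])

lemmas coset_eqD = coset_eq_iff[THEN iffD1]
lemmas coset_eqI = coset_eq_iff[THEN iffD2]

lemma coset_representative:
  assumes "X \<in> carrier (R Quot jacobson_radical R)"
  obtains x where "x \<in> carrier R" "X = jacobson_radical R +> x"
proof -
  have "carrier (R Quot jacobson_radical R) = (\<Union>x\<in>carrier R. {jacobson_radical R +> x})"
    unfolding FactRing_simps by simp
  then show thesis
    using assms that by blast
qed

section \<open>Lifting from the quotient by the radical\<close>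

lemma regular_modulo_radical:
  assumes a: "a \<in> carrier R"
  obtains d where "d \<in> carrier R" "a \<ominus> a \<otimes> d \<otimes> a \<in> jacobson_radical R"
proof -
  obtain B where B: "B \<in> carrier (R Quot jacobson_radical R)"
    "(jacobson_radical R +> a) \<otimes>\<^bsub>R Quot jacobson_radical R\<^esub> B
      \<otimes>\<^bsub>R Quot jacobson_radical R\<^esub> (jacobson_radical R +> a) = jacobson_radical R +> a"
    using Q.von_Neumann_regular[OF hom_closed[OF a]] .
  obtain d where d: "d \<in> carrier R" "B = jacobson_radical R +> d"
    using coset_representative[OF B(1)] .
  have "jacobson_radical R +> a = jacobson_radical R +> (a \<otimes> d \<otimes> a)"
    using a d B(2) by simp
  then have "a \<ominus> a \<otimes> d \<otimes> a \<in> jacobson_radical R"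
    by (rule coset_eqD[rotated 2]) (use a d(1) in simp_all)
  with d that show thesis
    by blast
qed

text \<open>If \<open>y\<close> represents the inverse coset, then \<open>x \<otimes> y\<close> and
  \<open>y \<otimes> x\<close> differ from \<open>\<one>\<close> by radical elements and are units,
  so \<open>x\<close> has a right and a left inverse.\<close>

lemma unit_lifts_modulo_radical:
  assumes x: "x \<in> carrier R" and X: "jacobson_radical R +> x \<in> Units (R Quot jacobson_radical R)"
  shows "x \<in> Units R"
proof -
  obtain Y where Y: "Y \<in> carrier (R Quot jacobson_radical R)"
    "(jacobson_radical R +> x) \<otimes>\<^bsub>R Quot jacobson_radical R\<^esub> Y = \<one>\<^bsub>R Quot jacobson_radical R\<^esub>"
    "Y \<otimes>\<^bsub>R Quot jacobson_radical R\<^esub> (jacobson_radical R +> x) = \<one>\<^bsub>R Quot jacobson_radical R\<^esub>"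
    using X by (auto simp: Units_def)
  obtain y where y: "y \<in> carrier R" "Y = jacobson_radical R +> y"
    using coset_representative[OF Y(1)] .
  have unit: "r \<in> Units R" if "r \<in> carrier R" "\<one> \<ominus> r \<in> jacobson_radical R" for r
    using one_minus_radical_unit[OF that(2)] that(1)
    by (simp add: minus_eq minus_add a_assoc[symmetric] r_neg)
  have "jacobson_radical R +> \<one> = jacobson_radical R +> (x \<otimes> y)"
    "jacobson_radical R +> \<one> = jacobson_radical R +> (y \<otimes> x)"
    using x y Y by simp_all
  then have "\<one> \<ominus> x \<otimes> y \<in> jacobson_radical R" "\<one> \<ominus> y \<otimes> x \<in> jacobson_radical R"
    using x y(1) coset_eqD[of \<one>] by blast+
  then have xy: "x \<otimes> y \<in> Units R" "y \<otimes> x \<in> Units R"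
    using x y(1) unit by blast+
  define r where "r = y \<otimes> inv (x \<otimes> y)"
  define l where "l = inv (y \<otimes> x) \<otimes> y"
  have rl: "r \<in> carrier R" "l \<in> carrier R"
    using xy y by (auto simp: r_def l_def)
  have "x \<otimes> r = \<one>" "l \<otimes> x = \<one>"
    using xy x y(1) by (simp_all add: r_def l_def m_assoc[symmetric]) (simp add: m_assoc)
  moreover from this have "l = r"
    using rl x inv_unique by blast
  ultimately show ?thesis
    using rl x by (auto simp: Units_def)
qed

text \<open>\<open>unit_partner\<close> applied in the semisimple quotient; the unit found there
  lifts to a unit of \<open>R\<close>.\<close>

lemma unit_partner_modulo_radical:
  assumes b: "b \<in> carrier R" and t: "t \<in> carrier R"
    and btb: "b \<ominus> b \<otimes> t \<otimes> b \<in> jacobson_radical R"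
  obtains x where "x \<in> Units R" "b \<otimes> x \<ominus> b \<otimes> t \<in> jacobson_radical R"
proof -
  have "jacobson_radical R +> b = jacobson_radical R +> (b \<otimes> t \<otimes> b)"
    by (rule coset_eqI[rotated 2]) (use b t btb in simp_all)
  then have "(jacobson_radical R +> b) \<otimes>\<^bsub>R Quot jacobson_radical R\<^esub> (jacobson_radical R +> t)
      \<otimes>\<^bsub>R Quot jacobson_radical R\<^esub> (jacobson_radical R +> b) = jacobson_radical R +> b"
    using b t by (metis hom_mult m_closed)
  then obtain X where X: "X \<in> Units (R Quot jacobson_radical R)"
    "(jacobson_radical R +> b) \<otimes>\<^bsub>R Quot jacobson_radical R\<^esub> X
      = (jacobson_radical R +> b) \<otimes>\<^bsub>R Quot jacobson_radical R\<^esub> (jacobson_radical R +> t)"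
    using Q.unit_partner[OF hom_closed[OF b] hom_closed[OF t]] by blast
  obtain x where x: "x \<in> carrier R" "X = jacobson_radical R +> x"
    using coset_representative[OF Q.Units_closed[OF X(1)]] .
  have "jacobson_radical R +> (b \<otimes> x) = jacobson_radical R +> (b \<otimes> t)"
    using b t x X(2) by simp
  then have "b \<otimes> x \<ominus> b \<otimes> t \<in> jacobson_radical R"
    by (rule coset_eqD[rotated 2]) (use b t x(1) in simp_all)
  moreover have "x \<in> Units R"
    using unit_lifts_modulo_radical[OF x(1)] X(1) unfolding x(2) by blast
  ultimately show thesis
    using that by blast
qed

text \<open>With \<open>d\<close> a quasi-inverse of \<open>a\<close> modulo the radical,
  \<open>a \<otimes> d\<close> is idempotent there and lifts to \<open>e\<close>; a unit
  \<open>x\<close> then replaces \<open>d\<close>.\<close>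

lemma associated_idempotent_modulo_radical:
  assumes a: "a \<in> carrier R"
  obtains x e where "x \<in> Units R" "e \<in> carrier R" "e \<otimes> e = e" "a \<otimes> x \<ominus> e \<in> jacobson_radical R"
proof -
  obtain d where d: "d \<in> carrier R" "a \<ominus> a \<otimes> d \<otimes> a \<in> jacobson_radical R"
    using regular_modulo_radical[OF a] .
  obtain x where x: "x \<in> Units R" "a \<otimes> x \<ominus> a \<otimes> d \<in> jacobson_radical R"
    using unit_partner_modulo_radical[OF a d] .
  have "jacobson_radical R +> a = jacobson_radical R +> (a \<otimes> d \<otimes> a)"
    by (rule coset_eqI[rotated 2]) (use a d in simp_all)
  then have "jacobson_radical R +> (a \<otimes> d \<otimes> a \<otimes> d) = jacobson_radical R +> (a \<otimes> d)"
    using a d(1) hom_mult m_closed by metis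
  moreover have "(jacobson_radical R +> (a \<otimes> d)) \<otimes>\<^bsub>R Quot jacobson_radical R\<^esub>
      (jacobson_radical R +> (a \<otimes> d)) = jacobson_radical R +> (a \<otimes> d \<otimes> a \<otimes> d)"
    using a d(1) by (simp only: hom_mult[symmetric] m_closed m_assoc)
  ultimately have "idempotent (R Quot jacobson_radical R) (jacobson_radical R +> (a \<otimes> d))"
    using a d(1) hom_closed by (simp only: idempotent_def m_closed)
  then obtain e where e: "e \<in> carrier R" "e \<otimes> e = e"
    "jacobson_radical R +> e = jacobson_radical R +> (a \<otimes> d)"
    using idempotents_lift_modulo_radical
    unfolding idempotents_lift_modulo_def idempotent_def by blast
  have "jacobson_radical R +> (a \<otimes> x) = jacobson_radical R +> (a \<otimes> d)"
    by (rule coset_eqI[rotated 2]) (use a d(1) x in auto)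
  then have "jacobson_radical R +> (a \<otimes> x) = jacobson_radical R +> e"
    unfolding e(3) .
  then have "a \<otimes> x \<ominus> e \<in> jacobson_radical R"
    by (rule coset_eqD[rotated 2]) (use a x(1) e(1) in auto)
  with x(1) e(1,2) that show thesis
    by blast
qed

text \<open>A unit \<open>x\<close> gives \<open>c \<otimes> x = f \<oplus> j\<close> with
  \<open>j\<close> radical. Since \<open>f\<close> fixes \<open>c\<close>, it fixes
  \<open>j\<close>, so \<open>c \<otimes> x = f \<otimes> (\<one> \<oplus> j)\<close>, and the unit
  \<open>\<one> \<oplus> j\<close> can be divided out.\<close>

lemma unit_right_multiplier:
  assumes c: "c \<in> carrier R" and t: "t \<in> carrier R" and f: "f \<in> carrier R" "f \<otimes> f = f"
    and fc: "f \<otimes> c = c" and ct: "c \<otimes> t = f"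
  obtains x where "x \<in> Units R" "c \<otimes> x = f"
proof -
  have "c \<ominus> c \<otimes> t \<otimes> c = \<zero>"
    using c ct fc by (simp add: minus_eq_zero_iff)
  then obtain x where x: "x \<in> Units R" "c \<otimes> x \<ominus> f \<in> jacobson_radical R"
    unfolding ct[symmetric] using unit_partner_modulo_radical[OF c t] by auto
  define j where "j = c \<otimes> x \<ominus> f"
  have xc: "x \<in> carrier R"
    using x by blast
  have jc: "j \<in> carrier R" and u: "\<one> \<oplus> j \<in> Units R"
    using c f x(2) xc one_plus_radical_unit by (auto simp: j_def)
  have "f \<otimes> (\<one> \<oplus> j) = f \<oplus> (f \<otimes> c \<otimes> x \<ominus> f \<otimes> f)"
    unfolding j_def using c f(1) xc by (simp add: minus_eq r_distr r_minus m_assoc)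
  also have "\<dots> = c \<otimes> x"
    unfolding fc f(2) using c f(1) xc by (simp add: minus_eq a_lcomm[of f "c \<otimes> x"] r_neg)
  finally have "c \<otimes> (x \<otimes> inv (\<one> \<oplus> j)) = f \<otimes> (\<one> \<oplus> j) \<otimes> inv (\<one> \<oplus> j)"
    using c xc u by (simp add: m_assoc)
  also have "\<dots> = f"
    using f(1) u by (simp add: m_assoc Units_closed)
  finally show thesis
    using that x(1) u Units_inv_Units by blast
qed

end

section \<open>Unimodular pairs\<close>

lemma (in ring) one_minus_square_zero_unit:
  assumes n: "n \<in> carrier R" "n \<otimes> n = \<zero>"
  shows "\<one> \<ominus> n \<in> Units R"
proof -
  have "(\<one> \<ominus> n) \<otimes> (\<one> \<oplus> n) = \<one>" "(\<one> \<oplus> n) \<otimes> (\<one> \<ominus> n) = \<one>"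
    using n by (simp_all add: minus_eq l_distr r_distr l_minus r_minus a_assoc r_neg l_neg r_neg1 r_neg2)
  then show ?thesis
    using n(1) by (auto simp: Units_def)
qed

text \<open>By \<open>fB\<close>, the matrix of \<open>B\<close> in Peirce blocks is triangular with
  \<open>f = \<one> \<ominus> e\<close> as one diagonal entry. The unit
  \<open>\<one> \<ominus> n\<close> clears the off-diagonal block \<open>n\<close>, leaving
  \<open>f \<oplus> c\<close> with \<open>c\<close> in the regular ring
  \<open>e R e\<close>.\<close>

lemma (in semiperfect_ring) regular_element_semisimple_corner:
  assumes B: "B \<in> carrier R" and e: "e \<in> carrier R" "e \<otimes> e = e"
    and fB: "(\<one> \<ominus> e) \<otimes> B = \<one> \<ominus> e"
    and corner: "\<And>j. j \<in> jacobson_radical R \<Longrightarrow> e \<otimes> j \<otimes> e = \<zero>"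
  shows "regular_element R B"
proof -
  define f where "f = \<one> \<ominus> e"
  have fc: "f \<in> carrier R" and ff: "f \<otimes> f = f" and ef: "e \<otimes> f = \<zero>" and fe: "f \<otimes> e = \<zero>"
    using e complement_idempotent[OF e] by (simp_all add: f_def)
  have fB': "f \<otimes> B = f"
    using fB by (simp add: f_def)
  have one: "\<one> = e \<oplus> f"
    using e(1) by (simp add: f_def minus_eq a_lcomm[of e \<one>] r_neg)
  define n where "n = e \<otimes> B \<otimes> f"
  define c where "c = e \<otimes> B \<otimes> e"
  have nc: "n \<in> carrier R" and cc: "c \<in> carrier R"
    using e B fc by (auto simp: n_def c_def)
  have "n \<otimes> n = e \<otimes> B \<otimes> (f \<otimes> e) \<otimes> B \<otimes> f"
    using e(1) B fc by (simp add: n_def m_assoc)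
  then have nn: "n \<otimes> n = \<zero>"
    using e(1) B fc by (simp add: fe)
  have nB: "n \<otimes> B = n"
    using e(1) B fc by (simp add: n_def m_assoc fB')
  have "B = (e \<oplus> f) \<otimes> B"
    using B by (simp add: one[symmetric])
  also have "\<dots> = e \<otimes> B \<otimes> \<one> \<oplus> f"
    using e(1) B fc by (simp add: l_distr fB')
  also have "\<dots> = e \<otimes> B \<otimes> (e \<oplus> f) \<oplus> f"
    by (simp only: one[symmetric])
  also have "\<dots> = c \<oplus> n \<oplus> f"
    using e(1) B fc by (simp add: r_distr c_def n_def)
  also have "\<dots> = n \<oplus> (f \<oplus> c)"
    using nc cc fc by (simp add: a_ac)
  finally have B_eq: "B = n \<oplus> (f \<oplus> c)" .
  have "(\<one> \<ominus> n) \<otimes> B = B \<ominus> n"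
    using B nc nB by (simp add: complement_mult)
  also have "\<dots> = (n \<oplus> (f \<oplus> c)) \<ominus> n"
    by (rule arg_cong[OF B_eq])
  also have "\<dots> = f \<oplus> c"
    using nc fc cc by (simp add: minus_eq a_comm[of _ "\<ominus> n"] r_neg1)
  finally have wB: "(\<one> \<ominus> n) \<otimes> B = f \<oplus> c" .
  obtain d where d: "d \<in> carrier R" "c \<ominus> c \<otimes> d \<otimes> c \<in> jacobson_radical R"
    using regular_modulo_radical[OF cc] .
  define g where "g = e \<otimes> d \<otimes> e"
  have gc: "g \<in> carrier R"
    using e d by (simp add: g_def)
  have ec: "e \<otimes> c = c" "c \<otimes> e = c" "f \<otimes> c = \<zero>" "c \<otimes> f = \<zero>"
    using e B fc ef fe mult_eq_extend[OF e(2) e(1) e(1)] mult_eq_extend[OF fe fc e(1)]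
    by (simp_all add: c_def m_assoc)
  have gf: "g \<otimes> f = \<zero>" "f \<otimes> g = \<zero>"
    using e d(1) fc ef mult_eq_extend[OF fe fc e(1)]
    by (simp_all add: g_def m_assoc)
  \<comment> \<open>The defect \<open>c \<ominus> c \<otimes> d \<otimes> c\<close> is radical and
    unchanged by cutting with \<open>e\<close>, so \<open>corner\<close> kills it; passing from
    \<open>d\<close> to \<open>g\<close> is harmless because \<open>e\<close> fixes \<open>c\<close>
    on both sides.\<close>
  have cgc: "c \<otimes> g \<otimes> c = c"
  proof -
    have "e \<otimes> (c \<ominus> c \<otimes> d \<otimes> c) \<otimes> e = (e \<otimes> c) \<otimes> e \<ominus> (e \<otimes> c) \<otimes> d \<otimes> (c \<otimes> e)"
      using e(1) cc d(1) by (simp add: minus_eq l_distr r_distr l_minus r_minus m_assoc)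
    then have "c \<ominus> c \<otimes> d \<otimes> c = \<zero>"
      using corner[OF d(2)] by (simp add: ec)
    then have cdc: "c \<otimes> d \<otimes> c = c"
      using cc d(1) minus_eq_zero_iff[of c "c \<otimes> d \<otimes> c"] by simp
    have "c \<otimes> g \<otimes> c = (c \<otimes> e) \<otimes> d \<otimes> (e \<otimes> c)"
      using e(1) cc d(1) by (simp add: g_def m_assoc)
    then show ?thesis
      by (simp add: ec cdc)
  qed
  have "regular_element R (f \<oplus> c)"
  proof (rule regular_elementI)
    have "(f \<oplus> c) \<otimes> (f \<oplus> g) = f \<oplus> c \<otimes> g"
      using fc cc gc by (simp add: l_distr r_distr ff ec gf)
    moreover have "c \<otimes> g \<otimes> f = \<zero>"
      using cc gc fc gf by (simp add: m_assoc)
    ultimately show "(f \<oplus> c) \<otimes> (f \<oplus> g) \<otimes> (f \<oplus> c) = f \<oplus> c"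
      using fc cc gc by (simp add: l_distr r_distr ff ec cgc)
  qed (use fc cc gc in auto)
  then have "regular_element R ((\<one> \<ominus> n) \<otimes> B)"
    by (simp only: wB)
  then show ?thesis
    by (rule regular_element_mult_unit_left[OF B one_minus_square_zero_unit[OF nc nn]])
qed

lemma (in semiperfect_ring) unimodular_pair_regular:
  assumes "VNL_ring R"
    and a: "a \<in> carrier R" and b: "b \<in> carrier R" and r: "r \<in> carrier R" and s: "s \<in> carrier R"
    and ab: "a \<otimes> r \<oplus> b \<otimes> s = \<one>"
  shows "regular_element R a \<or> regular_element R b"
proof (cases "regular_element R a")
  case na: False
  obtain x e where x: "x \<in> Units R" and e: "e \<in> carrier R" "e \<otimes> e = e"
    and axe: "a \<otimes> x \<ominus> e \<in> jacobson_radical R"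
    using associated_idempotent_modulo_radical[OF a] .
  have xc: "x \<in> carrier R" and ax: "a \<otimes> x \<in> carrier R"
    using x a by auto
  have "\<not> regular_element R (a \<otimes> x)"
    using na regular_element_mult_unit_right[OF a x] by blast
  \<comment> \<open>Non-regularity makes the radical corner at \<open>\<one> \<ominus> e\<close>
    nonzero, so the VNL condition makes the one at \<open>e\<close> zero.\<close>
  then obtain i where i: "i \<in> jacobson_radical R" "(\<one> \<ominus> e) \<otimes> i \<otimes> (\<one> \<ominus> e) \<noteq> \<zero>"
    using regular_element_near_idempotent[OF ax e axe] by blast
  have corner: "e \<otimes> k \<otimes> e = \<zero>" if "k \<in> jacobson_radical R" for k
    by (rule VNL_ring.radical_corner_alternative[OF assms(1) e i that])
  define f where "f = \<one> \<ominus> e"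
  have fc: "f \<in> carrier R" and ff: "f \<otimes> f = f" and fe: "f \<otimes> e = \<zero>"
    using e complement_idempotent[OF e] by (simp_all add: f_def)
  define j where "j = a \<otimes> x \<ominus> e"
  have j: "j \<in> jacobson_radical R" "j \<in> carrier R"
    using axe ax e by (simp_all add: j_def)
  define r' where "r' = inv x \<otimes> r"
  have r': "r' \<in> carrier R"
    using x r by (simp add: r'_def)
  \<comment> \<open>Here \<open>a \<otimes> r = (e \<oplus> j) \<otimes> r'\<close> and
    \<open>f \<otimes> e = \<zero>\<close>, so \<open>f\<close> times the unimodular relation reads
    \<open>f \<otimes> (b \<otimes> s) = f \<otimes> v\<close>, with \<open>v\<close> a
    unit.\<close>
  define v where "v = \<one> \<ominus> j \<otimes> r'"
  have v: "v \<in> Units R" "v \<in> carrier R"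
    using one_minus_radical_unit[OF J.I_r_closed[OF j(1) r']] by (auto simp: v_def)
  have "f \<otimes> j = f \<otimes> (a \<otimes> x) \<ominus> f \<otimes> e"
    unfolding j_def using fc ax e(1) by (simp add: minus_eq r_distr r_minus)
  then have fj: "f \<otimes> j = f \<otimes> (a \<otimes> x)"
    using fc ax by (simp add: fe minus_eq)
  have "f \<otimes> (j \<otimes> r') = f \<otimes> j \<otimes> r'"
    using fc j r' by (simp add: m_assoc)
  also have "\<dots> = f \<otimes> (a \<otimes> (x \<otimes> inv x \<otimes> r))"
    unfolding fj r'_def using fc a xc x r by (simp add: m_assoc del: Units_r_inv)
  also have "\<dots> = f \<otimes> (a \<otimes> r)"
    using x r by simp
  finally have fjr: "f \<otimes> (j \<otimes> r') = f \<otimes> (a \<otimes> r)" .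
  have "f \<otimes> (a \<otimes> r) \<oplus> f \<otimes> (b \<otimes> s) = f"
    using arg_cong[OF ab, of "\<lambda>w. f \<otimes> w"] fc a b r s by (simp add: r_distr)
  moreover have "f \<otimes> (a \<otimes> r) \<oplus> f \<otimes> v = f"
    unfolding v_def fjr[symmetric] using fc j(2) r'
    by (simp add: r_distr r_minus minus_eq a_lcomm[of "f \<otimes> (j \<otimes> r')" f] r_neg)
  ultimately have "f \<otimes> (a \<otimes> r) \<oplus> f \<otimes> (b \<otimes> s) = f \<otimes> (a \<otimes> r) \<oplus> f \<otimes> v"
    by (simp only:)
  then have fbs: "f \<otimes> (b \<otimes> s) = f \<otimes> v"
    using fc a b r s v(2) by simp
  have "f \<otimes> b \<otimes> (s \<otimes> inv v) = f \<otimes> (b \<otimes> s) \<otimes> inv v"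
    using fc b s v by (simp add: m_assoc)
  also have "\<dots> = f"
    unfolding fbs using fc v by (simp add: m_assoc)
  finally have fbt: "f \<otimes> b \<otimes> (s \<otimes> inv v) = f" .
  have fb: "f \<otimes> (f \<otimes> b) = f \<otimes> b"
    using mult_eq_extend[OF ff fc fc b] .
  \<comment> \<open>The multiplier \<open>s \<otimes> inv v\<close>, which takes
    \<open>f \<otimes> b\<close> to \<open>f\<close>, is traded for a unit \<open>y\<close>, so
    \<open>b\<close> may be replaced by \<open>b \<otimes> y\<close>.\<close>
  obtain y where y: "y \<in> Units R" "f \<otimes> b \<otimes> y = f"
    using unit_right_multiplier[OF m_closed[OF fc b] m_closed[OF s Units_inv_closed[OF v(1)]] fc ff fb fbt] .
  have by_carrier: "b \<otimes> y \<in> carrier R"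
    using b y(1) by auto
  have "f \<otimes> (b \<otimes> y) = f"
    using y fc b by (simp add: m_assoc Units_closed)
  then have "regular_element R (b \<otimes> y)"
    unfolding f_def by (rule regular_element_semisimple_corner[OF by_carrier e _ corner])
  then have "regular_element R b"
    by (rule regular_element_mult_unit_right[OF b y(1)])
  then show ?thesis ..
qed simp

theorem theorem4p7:
  fixes R :: "('a, 'b) ring_scheme" (structure)
  assumes "semiperfect_ring R" and "VNL_ring R"
  shows "n_VNL_ring 2 R \<and>
    (\<forall>a\<^sub>1 \<in> carrier R. \<forall>a\<^sub>2 \<in> carrier R.
       (a\<^sub>1 <# carrier R) <+> (a\<^sub>2 <# carrier R) = carrier R \<longrightarrow>
         regular_element R a\<^sub>1 \<or> regular_element R a\<^sub>2)"
proof -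
  interpret semiperfect_ring R by fact
  \<comment> \<open>Both forms of unimodularity in the goal reduce to an equation expressing
    \<open>\<one>\<close> through \<open>a\<close> and \<open>b\<close>.\<close>
  have pair: "regular_element R a \<or> regular_element R b"
    if "a \<in> carrier R" "b \<in> carrier R" "r \<in> carrier R" "s \<in> carrier R" "\<one> = a \<otimes> r \<oplus> b \<otimes> s"
    for a b r s
    using unimodular_pair_regular[OF assms(2) that(1-4) that(5)[symmetric]] .
  have "n_VNL_ring 2 R"
  proof (intro n_VNL_ring.intro n_VNL_ring_axioms.intro ring_axioms)
    fix a :: "nat \<Rightarrow> 'a"
    assume a: "a \<in> {1..2} \<rightarrow> carrier R"
      and "{(\<Oplus>i\<in>{1..2}. a i \<otimes> r i) |r. r \<in> {1..2} \<rightarrow> carrier R} = carrier R"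
    then have "\<one> \<in> {(\<Oplus>i\<in>{1..2}. a i \<otimes> r i) |r. r \<in> {1..2} \<rightarrow> carrier R}"
      by simp
    then obtain r where r: "r \<in> {1..2} \<rightarrow> carrier R" and one: "\<one> = (\<Oplus>i\<in>{1..2}. a i \<otimes> r i)"
      by blast
    have set: "{1..2} = {1, 2::nat}"
      by auto
    have c: "a 1 \<in> carrier R" "a 2 \<in> carrier R" "r 1 \<in> carrier R" "r 2 \<in> carrier R"
      using a r by (auto simp: Pi_iff)
    have "(\<Oplus>i\<in>{1, 2}. a i \<otimes> r i) = a 1 \<otimes> r 1 \<oplus> a 2 \<otimes> r 2"
      using c by (simp add: finsum_insert)
    then have "regular_element R (a 1) \<or> regular_element R (a 2)"
      using pair[OF c] one unfolding set by simp
    then show "\<exists>i\<in>{1..2}. regular_element R (a i)"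
      by auto
  qed
  moreover have "regular_element R a \<or> regular_element R b"
    if ab: "a \<in> carrier R" "b \<in> carrier R" "(a <# carrier R) <+> (b <# carrier R) = carrier R" for a b
  proof -
    have "\<one> \<in> (a <# carrier R) <+> (b <# carrier R)"
      unfolding ab(3) by simp
    then obtain r s where "r \<in> carrier R" "s \<in> carrier R" "\<one> = a \<otimes> r \<oplus> b \<otimes> s"
      unfolding set_add_def' l_coset_def by blast
    then show ?thesis
      using pair[OF ab(1,2)] by blast
  qed
  ultimately show ?thesis
    by blast
qed

end
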